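(* Let $K$ and $L$ be compact Hausdorff spaces and let $T:C(K)\to C(L)$ be an isomorphic embedding such that its envelope $e^T$ is continuous and positive everywhere on $L$ (i.e. $e^T(y)>0$ for every $y\in L$). Then there exists a positive isomorphic embedding of $C(K)$ into $C(L\times 2)$.
   Context: $C(K)$ is the Banach space of real-valued continuous functions on $K$ with the supremum norm. An isomorphic embedding $T:C(K)\to C(L)$ is a linear operator (not necessarily surjective) for which there are constants $m_1,m_2>0$ with $m_1\|g\|\le\|Tg\|\le m_2\|g\|$ for all $g\in C(K)$. An operator $S$ between such spaces is positive if $g\ge 0$ implies $Sg\ge 0$. For a bounded operator $T:C(K)\to C(L)$ the envelope $e^T:L\to\mathbb{R}$ is $e^T(y)=\sup\{Tg(y): g\in C(K),\ \|g\|\le 1\}$. Here $2=\{0,1\}$ is the two-point discrete space. *)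

theory Defs
  imports "HOL-Analysis.Bounded_Continuous_Function"
begin

(* For a compact space 'k every continuous real function is bounded, so the library's normed
   space 'k \<Rightarrow>\<^sub>C real of bounded continuous functions is C(K) with the supremum norm. *)

definition isomorphic_embedding ::
  "(('k::topological_space \<Rightarrow>\<^sub>C real) \<Rightarrow> ('l::topological_space \<Rightarrow>\<^sub>C real)) \<Rightarrow> bool"
  where "isomorphic_embedding T \<longleftrightarrow> linear T \<and>
    (\<exists>m1>0. \<exists>m2>0. \<forall>g. m1 * norm g \<le> norm (T g) \<and> norm (T g) \<le> m2 * norm g)"

definition positive_operator ::
  "(('k::topological_space \<Rightarrow>\<^sub>C real) \<Rightarrow> ('l::topological_space \<Rightarrow>\<^sub>C real)) \<Rightarrow> bool"
  where "positive_operator S \<longleftrightarrow>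
    (\<forall>g. (\<forall>x. 0 \<le> apply_bcontfun g x) \<longrightarrow> (\<forall>y. 0 \<le> apply_bcontfun (S g) y))"

(* The supremum is a genuine one (of a nonempty set bounded above) for bounded linear T. *)
definition envelope ::
  "(('k::topological_space \<Rightarrow>\<^sub>C real) \<Rightarrow> ('l::topological_space \<Rightarrow>\<^sub>C real)) \<Rightarrow> 'l \<Rightarrow> real"
  where "envelope T y = (SUP g\<in>{g. norm g \<le> 1}. apply_bcontfun (T g) y)"

end

theory Submission
  imports Defs
begin

text \<open>
  For each \<open>y \<in> L\<close> the functional \<open>\<phi>\<^sub>y = (\<lambda>g. T g y)\<close> is a signed measure on \<open>K\<close>, and
  \<open>envelope T y\<close> is its total variation. The embedding sends \<open>g\<close> to the function on
  \<open>L \<times> 2\<close> that consists of the integrals of \<open>g\<close> against the positive and the negative part of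
  \<open>\<phi>\<^sub>y\<close>. It is positive, and \<open>T g\<close> is the difference of the two halves, so it inherits the lower
  bound of \<open>T\<close> up to a factor 2. What has to be seen is that its values are continuous
  in \<open>y\<close>; this is where continuity of the envelope enters.

  No measures are used: the variation is the modulus of \<open>\<phi>\<close> in the sense of
  Riesz and Kantorovich, \<open>\<bar>\<phi>\<bar> g = sup {\<phi> h | \<bar>h\<bar> \<le> g}\<close> for \<open>g \<ge> 0\<close>, which is additive
  on the positive cone (\<open>modulus_add\<close>) and therefore extends to a linear functional
  (\<open>modulus_ext\<close>). For fixed \<open>g \<ge> 0\<close>, \<open>y \<mapsto> \<bar>\<phi>\<^sub>y\<bar> g\<close> is a supremum of continuous functions, hence
  lower semicontinuous. If \<open>g \<le> c\<close> for a constant \<open>c\<close>, then \<open>\<bar>\<phi>\<^sub>y\<bar> g + \<bar>\<phi>\<^sub>y\<bar> (c - g)\<close> is \<open>c\<close> times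
  the envelope; two lower semicontinuous functions with a continuous sum are continuous
  (\<open>continuous_on_modulus\<close>).
\<close>

section \<open>The modulus of a bounded functional on the positive cone\<close>

definition modulus :: "(('k::topological_space \<Rightarrow>\<^sub>C real) \<Rightarrow> real) \<Rightarrow> ('k \<Rightarrow>\<^sub>C real) \<Rightarrow> real" where
  "modulus \<phi> g = (SUP h\<in>{h. \<forall>x. \<bar>apply_bcontfun h x\<bar> \<le> apply_bcontfun g x}. \<phi> h)"

lemma modulus_bdd_above:
  fixes \<phi> :: "('k::topological_space \<Rightarrow>\<^sub>C real) \<Rightarrow> real"
  assumes "bounded_linear \<phi>"
  shows "bdd_above (\<phi> ` {h. \<forall>x. \<bar>apply_bcontfun h x\<bar> \<le> apply_bcontfun g x})"
proof -
  from bounded_linear.pos_bounded[OF assms] obtain C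
    where C: "C > 0" "\<And>h. norm (\<phi> h) \<le> norm h * C" by blast
  show ?thesis
  proof (rule bdd_aboveI2)
    fix h assume "h \<in> {h. \<forall>x. \<bar>apply_bcontfun h x\<bar> \<le> apply_bcontfun g x}"
    then have le: "\<bar>apply_bcontfun h x\<bar> \<le> apply_bcontfun g x" for x by blast
    have "norm h \<le> norm g"
    proof (rule norm_bound)
      show "norm (apply_bcontfun h x) \<le> norm g" for x
        using le[of x] norm_bounded[of g x] by simp
    qed
    then have "norm h * C \<le> norm g * C" using C(1) by simp
    then show "\<phi> h \<le> norm g * C" using C(2)[of h] by simp
  qed
qed

lemma modulus_upper:
  assumes "bounded_linear \<phi>" "\<And>x. \<bar>apply_bcontfun h x\<bar> \<le> apply_bcontfun g x"
  shows "\<phi> h \<le> modulus \<phi> g"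
  unfolding modulus_def using assms by (intro cSUP_upper modulus_bdd_above) auto

lemma modulus_least:
  assumes "\<And>x. 0 \<le> apply_bcontfun g x"
    and "\<And>h. (\<And>x. \<bar>apply_bcontfun h x\<bar> \<le> apply_bcontfun g x) \<Longrightarrow> \<phi> h \<le> c"
  shows "modulus \<phi> g \<le> c"
  unfolding modulus_def
proof (rule cSUP_least)
  show "{h. \<forall>x. \<bar>apply_bcontfun h x\<bar> \<le> apply_bcontfun g x} \<noteq> {}"
    using assms(1) by (auto intro!: exI[of _ 0])
qed (use assms(2) in auto)

text \<open>The Riesz decomposition property of the lattice of bounded continuous functions; the first
  summand is the truncation of \<open>k\<close> to the order interval \<open>[-g, g]\<close>.\<close>

lemma bcontfun_riesz_decomposition:
  fixes g h k :: "'k::topological_space \<Rightarrow>\<^sub>C real"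
  assumes g: "\<And>x. 0 \<le> apply_bcontfun g x"
    and k: "\<And>x. \<bar>apply_bcontfun k x\<bar> \<le> apply_bcontfun g x + apply_bcontfun h x"
    and h: "\<And>x. 0 \<le> apply_bcontfun h x"
  obtains k1 k2 where "k = k1 + k2" "\<And>x. \<bar>apply_bcontfun k1 x\<bar> \<le> apply_bcontfun g x"
    "\<And>x. \<bar>apply_bcontfun k2 x\<bar> \<le> apply_bcontfun h x"
proof -
  define f where "f x = max (- apply_bcontfun g x) (min (apply_bcontfun g x) (apply_bcontfun k x))" for x
  have fg: "\<bar>f x\<bar> \<le> apply_bcontfun g x" for x
    using g[of x] by (auto simp: f_def)
  have "f \<in> bcontfun"
  proof (rule bcontfun_normI)
    show "continuous_on UNIV f" unfolding f_def by (intro continuous_intros) auto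
    show "norm (f x) \<le> norm g" for x
      using fg[of x] norm_bounded[of g x] by simp
  qed
  then obtain k1 where k1: "f = apply_bcontfun k1" by (rule bcontfunE)
  have "\<bar>apply_bcontfun (k - k1) x\<bar> \<le> apply_bcontfun h x" for x
    using g[of x] h[of x] k[of x] unfolding minus_bcontfun.rep_eq k1[symmetric] f_def
    by (auto simp: max_def min_def)
  moreover have "k = k1 + (k - k1)" by simp
  ultimately show ?thesis using that fg k1 by metis
qed

lemma modulus_add:
  assumes \<phi>: "bounded_linear \<phi>"
    and g: "\<And>x. 0 \<le> apply_bcontfun g x" and h: "\<And>x. 0 \<le> apply_bcontfun h x"
  shows "modulus \<phi> (g + h) = modulus \<phi> g + modulus \<phi> h"
proof (rule antisym)
  show "modulus \<phi> (g + h) \<le> modulus \<phi> g + modulus \<phi> h"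
  proof (rule modulus_least)
    show "0 \<le> apply_bcontfun (g + h) x" for x using g h by simp
    fix k assume "\<And>x. \<bar>apply_bcontfun k x\<bar> \<le> apply_bcontfun (g + h) x"
    then have "\<And>x. \<bar>apply_bcontfun k x\<bar> \<le> apply_bcontfun g x + apply_bcontfun h x" by simp
    from bcontfun_riesz_decomposition[OF g this h] obtain k1 k2
      where k: "k = k1 + k2" "\<And>x. \<bar>apply_bcontfun k1 x\<bar> \<le> apply_bcontfun g x"
        "\<And>x. \<bar>apply_bcontfun k2 x\<bar> \<le> apply_bcontfun h x" by blast
    then show "\<phi> k \<le> modulus \<phi> g + modulus \<phi> h"
      using modulus_upper[OF \<phi> k(2)] modulus_upper[OF \<phi> k(3)]
      by (simp add: linear_add[OF bounded_linear.linear[OF \<phi>]])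
  qed
next
  have "\<phi> k + \<phi> l \<le> modulus \<phi> (g + h)"
    if kl: "\<And>x. \<bar>apply_bcontfun k x\<bar> \<le> apply_bcontfun g x"
      "\<And>x. \<bar>apply_bcontfun l x\<bar> \<le> apply_bcontfun h x" for k l
  proof -
    have "\<bar>apply_bcontfun (k + l) x\<bar> \<le> apply_bcontfun (g + h) x" for x
      using kl[of x] by simp
    from modulus_upper[OF \<phi> this] show ?thesis
      by (simp add: linear_add[OF bounded_linear.linear[OF \<phi>]])
  qed
  then have "\<phi> k \<le> modulus \<phi> (g + h) - \<phi> l"
    if "\<And>x. \<bar>apply_bcontfun k x\<bar> \<le> apply_bcontfun g x"
      "\<And>x. \<bar>apply_bcontfun l x\<bar> \<le> apply_bcontfun h x" for k l
    using that by (simp add: le_diff_eq)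
  then have "modulus \<phi> g \<le> modulus \<phi> (g + h) - \<phi> l"
    if "\<And>x. \<bar>apply_bcontfun l x\<bar> \<le> apply_bcontfun h x" for l
    using that by (intro modulus_least[OF g]) blast
  then have "\<phi> l \<le> modulus \<phi> (g + h) - modulus \<phi> g"
    if "\<And>x. \<bar>apply_bcontfun l x\<bar> \<le> apply_bcontfun h x" for l
    using that by (simp add: le_diff_eq add.commute)
  then have "modulus \<phi> h \<le> modulus \<phi> (g + h) - modulus \<phi> g"
    by (intro modulus_least[OF h]) blast
  then show "modulus \<phi> g + modulus \<phi> h \<le> modulus \<phi> (g + h)" by simp
qed

lemma modulus_zero: "bounded_linear \<phi> \<Longrightarrow> modulus \<phi> 0 = 0"
  using modulus_add[of \<phi> 0 0] by simp

lemma modulus_scaleR_le: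
  assumes \<phi>: "bounded_linear \<phi>" and g: "\<And>x. 0 \<le> apply_bcontfun g x" and c: "c > 0"
  shows "modulus \<phi> (c *\<^sub>R g) \<le> c * modulus \<phi> g"
proof (rule modulus_least)
  show "0 \<le> apply_bcontfun (c *\<^sub>R g) x" for x using g c by simp
  fix h assume "\<And>x. \<bar>apply_bcontfun h x\<bar> \<le> apply_bcontfun (c *\<^sub>R g) x"
  then have "\<bar>apply_bcontfun ((1 / c) *\<^sub>R h) x\<bar> \<le> apply_bcontfun g x" for x
    using c by (simp add: abs_mult field_simps)
  from modulus_upper[OF \<phi> this] have "(1 / c) * \<phi> h \<le> modulus \<phi> g"
    by (simp only: linear_scale[OF bounded_linear.linear[OF \<phi>]] real_scaleR_def)
  then show "\<phi> h \<le> c * modulus \<phi> g"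
    using c by (simp add: field_simps)
qed

lemma modulus_scaleR:
  assumes \<phi>: "bounded_linear \<phi>" and g: "\<And>x. 0 \<le> apply_bcontfun g x" and c: "c \<ge> 0"
  shows "modulus \<phi> (c *\<^sub>R g) = c * modulus \<phi> g"
proof (cases "c = 0")
  case True
  then show ?thesis by (simp add: modulus_zero[OF \<phi>])
next
  case False
  with c have c: "c > 0" by simp
  have "0 \<le> apply_bcontfun (c *\<^sub>R g) x" for x using g c by simp
  from modulus_scaleR_le[OF \<phi> this, of "1 / c"]
  have "c * modulus \<phi> g \<le> modulus \<phi> (c *\<^sub>R g)" using c by (simp add: field_simps)
  with modulus_scaleR_le[OF \<phi> g c] show ?thesis by simp
qed

lemma modulus_const:
  fixes \<phi> :: "('k::topological_space \<Rightarrow>\<^sub>C real) \<Rightarrow> real"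
  assumes "bounded_linear \<phi>" "c \<ge> 0"
  shows "modulus \<phi> (const_bcontfun c) = c * modulus \<phi> (const_bcontfun 1)"
proof -
  have "const_bcontfun c = c *\<^sub>R (const_bcontfun 1 :: 'k \<Rightarrow>\<^sub>C real)"
    by (rule bcontfun_eqI) simp
  then show ?thesis using modulus_scaleR[OF assms(1) _ assms(2), of "const_bcontfun 1"] by simp
qed

section \<open>Extension of the modulus to a linear functional\<close>

text \<open>The norm of \<open>g\<close> serves as a constant that moves \<open>g\<close> into the positive cone; any
  other way to write \<open>g\<close> as a difference of nonnegative functions gives the same
  value (\<open>modulus_ext_diff\<close>).\<close>

definition modulus_ext :: "(('k::topological_space \<Rightarrow>\<^sub>C real) \<Rightarrow> real) \<Rightarrow> ('k \<Rightarrow>\<^sub>C real) \<Rightarrow> real" where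
  "modulus_ext \<phi> g = modulus \<phi> (g + const_bcontfun (norm g)) - modulus \<phi> (const_bcontfun (norm g))"

lemma bcontfun_add_norm_nonneg:
  fixes g :: "'k::topological_space \<Rightarrow>\<^sub>C real"
  shows "0 \<le> apply_bcontfun (g + const_bcontfun (norm g)) x"
  using norm_bounded[of g x] by simp

lemma modulus_ext_diff:
  assumes \<phi>: "bounded_linear \<phi>"
    and u: "\<And>x. 0 \<le> apply_bcontfun u x" and v: "\<And>x. 0 \<le> apply_bcontfun v x"
  shows "modulus_ext \<phi> (u - v) = modulus \<phi> u - modulus \<phi> v"
proof -
  let ?g = "u - v" and ?c = "const_bcontfun (norm (u - v)) :: _ \<Rightarrow>\<^sub>C real"
  have "modulus \<phi> (?g + ?c) + modulus \<phi> v = modulus \<phi> (?g + ?c + v)"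
    by (rule modulus_add[OF \<phi> bcontfun_add_norm_nonneg v, symmetric])
  also have "?g + ?c + v = u + ?c" by simp
  also have "modulus \<phi> (u + ?c) = modulus \<phi> u + modulus \<phi> ?c"
    by (rule modulus_add[OF \<phi> u]) simp
  finally show ?thesis by (simp add: modulus_ext_def)
qed

lemma modulus_ext_nonneg_eq:
  assumes "bounded_linear \<phi>" "\<And>x. 0 \<le> apply_bcontfun u x"
  shows "modulus_ext \<phi> u = modulus \<phi> u"
  using modulus_ext_diff[OF assms, of 0] modulus_zero[OF assms(1)] by simp

lemma bcontfun_diff_nonnegE:
  fixes g :: "'k::topological_space \<Rightarrow>\<^sub>C real"
  obtains u v where "g = u - v" "\<And>x. 0 \<le> apply_bcontfun u x" "\<And>x. 0 \<le> apply_bcontfun v x"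
  using that[of "g + const_bcontfun (norm g)" "const_bcontfun (norm g)"]
    bcontfun_add_norm_nonneg[of g] by simp

lemma linear_modulus_ext:
  assumes \<phi>: "bounded_linear \<phi>"
  shows "linear (modulus_ext \<phi>)"
proof (rule linearI)
  fix g h :: "'a \<Rightarrow>\<^sub>C real"
  obtain u v where g: "g = u - v" and uv: "\<And>x. 0 \<le> apply_bcontfun u x" "\<And>x. 0 \<le> apply_bcontfun v x"
    by (rule bcontfun_diff_nonnegE[of g]) blast
  obtain w z where h: "h = w - z" and wz: "\<And>x. 0 \<le> apply_bcontfun w x" "\<And>x. 0 \<le> apply_bcontfun z x"
    by (rule bcontfun_diff_nonnegE[of h]) blast
  have gh: "g + h = (u + w) - (v + z)" by (simp add: g h)
  have nn: "0 \<le> apply_bcontfun (u + w) x" "0 \<le> apply_bcontfun (v + z) x" for x using uv wz by simp_all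
  show "modulus_ext \<phi> (g + h) = modulus_ext \<phi> g + modulus_ext \<phi> h"
    unfolding gh modulus_ext_diff[OF \<phi> nn]
    by (simp add: g h modulus_ext_diff[OF \<phi>] modulus_add[OF \<phi>] uv wz)
next
  fix c :: real and g :: "'a \<Rightarrow>\<^sub>C real"
  obtain u v where g: "g = u - v" and uv: "\<And>x. 0 \<le> apply_bcontfun u x" "\<And>x. 0 \<le> apply_bcontfun v x"
    by (rule bcontfun_diff_nonnegE[of g]) blast
  show "modulus_ext \<phi> (c *\<^sub>R g) = c *\<^sub>R modulus_ext \<phi> g"
  proof (cases "c \<ge> 0")
    case True
    have "c *\<^sub>R g = c *\<^sub>R u - c *\<^sub>R v" by (simp add: g scaleR_diff_right)
    moreover have "modulus_ext \<phi> (c *\<^sub>R u - c *\<^sub>R v) = modulus \<phi> (c *\<^sub>R u) - modulus \<phi> (c *\<^sub>R v)"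
      using True uv by (intro modulus_ext_diff[OF \<phi>]) simp_all
    ultimately show ?thesis
      using True uv by (simp add: g modulus_scaleR[OF \<phi>] modulus_ext_diff[OF \<phi>] right_diff_distrib)
  next
    \<comment> \<open>a negative factor exchanges the two nonnegative parts\<close>
    case False
    have "c *\<^sub>R g = (- c) *\<^sub>R v - (- c) *\<^sub>R u" by (simp add: g scaleR_diff_right)
    moreover have "modulus_ext \<phi> ((- c) *\<^sub>R v - (- c) *\<^sub>R u)
        = modulus \<phi> ((- c) *\<^sub>R v) - modulus \<phi> ((- c) *\<^sub>R u)"
      using False uv
      by (intro modulus_ext_diff[OF \<phi>]) (simp_all add: mult_nonpos_nonneg)
    moreover have "modulus \<phi> ((- c) *\<^sub>R v) = - c * modulus \<phi> v"
      "modulus \<phi> ((- c) *\<^sub>R u) = - c * modulus \<phi> u"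
      using False uv by (intro modulus_scaleR[OF \<phi>]; simp)+
    ultimately show ?thesis
      using uv by (simp add: g modulus_ext_diff[OF \<phi>] algebra_simps)
  qed
qed

text \<open>This is what makes the positive part \<open>(\<bar>\<phi>\<bar> + \<phi>) / 2\<close> and the negative part
  \<open>(\<bar>\<phi>\<bar> - \<phi>) / 2\<close> positive functionals.\<close>

lemma abs_le_modulus_ext:
  assumes \<phi>: "bounded_linear \<phi>" and g: "\<And>x. 0 \<le> apply_bcontfun g x"
  shows "\<bar>\<phi> g\<bar> \<le> modulus_ext \<phi> g"
proof -
  have "\<phi> g \<le> modulus \<phi> g" "\<phi> (- g) \<le> modulus \<phi> g"
    using g by (intro modulus_upper[OF \<phi>]; simp)+
  then show ?thesis
    using modulus_ext_nonneg_eq[OF \<phi> g] by (simp add: linear_neg[OF bounded_linear.linear[OF \<phi>]])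
qed

text \<open>The modulus has no larger norm than the functional: by positivity it is
  controlled by its value at constants.\<close>

lemma abs_modulus_ext_le:
  fixes \<phi> :: "('k::topological_space \<Rightarrow>\<^sub>C real) \<Rightarrow> real"
  assumes \<phi>: "bounded_linear \<phi>" and C: "C \<ge> 0" "\<And>h. \<bar>\<phi> h\<bar> \<le> C * norm h"
  shows "\<bar>modulus_ext \<phi> g\<bar> \<le> C * norm g"
proof -
  let ?c = "const_bcontfun (norm g) :: 'k \<Rightarrow>\<^sub>C real"
  note lin = linear_modulus_ext[OF \<phi>]
  have le: "modulus \<phi> ?c \<le> C * norm g"
  proof (rule modulus_least)
    fix h :: "'k \<Rightarrow>\<^sub>C real" assume "\<And>x. \<bar>apply_bcontfun h x\<bar> \<le> apply_bcontfun ?c x"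
    then have "norm h \<le> norm g" by (intro norm_bound) simp
    then have "C * norm h \<le> C * norm g" using C(1) by (intro mult_left_mono)
    with C(2)[of h] show "\<phi> h \<le> C * norm g" by simp
  qed simp
  have "0 \<le> apply_bcontfun (?c - g) x" "0 \<le> apply_bcontfun (?c + g) x" for x
    using norm_bounded[of g x] by simp_all
  then have "0 \<le> modulus_ext \<phi> (?c - g)" "0 \<le> modulus_ext \<phi> (?c + g)"
    using abs_le_modulus_ext[OF \<phi>] by (meson abs_ge_zero order_trans)+
  moreover have "modulus_ext \<phi> ?c = modulus \<phi> ?c"
    by (rule modulus_ext_nonneg_eq[OF \<phi>]) simp
  ultimately show ?thesis
    using le by (simp add: linear_add[OF lin] linear_diff[OF lin])
qed

section \<open>Continuity in the parameter\<close>

lemma envelope_eq_modulus: "envelope T y = modulus (\<lambda>g. apply_bcontfun (T g) y) (const_bcontfun 1)"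
proof -
  have "norm g \<le> 1 \<longleftrightarrow> (\<forall>x. \<bar>apply_bcontfun g x\<bar> \<le> 1)" for g :: "'a \<Rightarrow>\<^sub>C real"
    using norm_bounded[of g] norm_bound[of g 1] by (auto intro: order_trans)
  then show ?thesis by (simp add: envelope_def modulus_def)
qed

lemma bounded_linear_apply_bcontfun:
  fixes T :: "'a::real_normed_vector \<Rightarrow> ('l::topological_space \<Rightarrow>\<^sub>C real)"
  assumes "linear T" "\<And>g. norm (T g) \<le> C * norm g"
  shows "bounded_linear (\<lambda>g. apply_bcontfun (T g) y)"
proof (rule bounded_linear_intro)
  show "norm (apply_bcontfun (T g) y) \<le> norm g * C" for g
    using norm_bounded[of "T g" y] assms(2)[of g] by (simp add: mult.commute)
qed (simp_all add: linear_add[OF assms(1)] linear_scale[OF assms(1)])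

lemma modulus_lower_semicontinuous:
  fixes T :: "('k::topological_space \<Rightarrow>\<^sub>C real) \<Rightarrow> ('l::topological_space \<Rightarrow>\<^sub>C real)"
  assumes bl: "\<And>y. bounded_linear (\<lambda>g. apply_bcontfun (T g) y)"
    and g: "\<And>x. 0 \<le> apply_bcontfun g x"
    and a: "a < modulus (\<lambda>g. apply_bcontfun (T g) y) g"
  shows "\<forall>\<^sub>F z in at y. a < modulus (\<lambda>g. apply_bcontfun (T g) z) g"
proof -
  obtain h where h: "\<And>x. \<bar>apply_bcontfun h x\<bar> \<le> apply_bcontfun g x" "a < apply_bcontfun (T h) y"
    using a modulus_least[OF g, of "\<lambda>g. apply_bcontfun (T g) y" a] by (meson not_le)
  have "(apply_bcontfun (T h) \<longlongrightarrow> apply_bcontfun (T h) y) (at y)"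
    using continuous_on_apply_bcontfun[of UNIV "T h"] by (simp add: continuous_on_def)
  then have "\<forall>\<^sub>F z in at y. a < apply_bcontfun (T h) z"
    using h(2) by (rule order_tendstoD)
  then show ?thesis
    by eventually_elim (use modulus_upper[OF bl h(1)] in \<open>blast intro: less_le_trans\<close>)
qed

lemma tendsto_if_lower_semicontinuous_sum:
  fixes f f' s :: "'l::topological_space \<Rightarrow> real"
  assumes f: "\<And>a. a < f y \<Longrightarrow> \<forall>\<^sub>F z in at y. a < f z"
    and f': "\<And>a. a < f' y \<Longrightarrow> \<forall>\<^sub>F z in at y. a < f' z"
    and s: "(s \<longlongrightarrow> s y) (at y)" and sum: "\<And>z. f z + f' z = s z"
  shows "(f \<longlongrightarrow> f y) (at y)"
proof (rule order_tendstoI)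
  fix a assume "f y < a"
  moreover define d where "d = (a - f y) / 2"
  ultimately have d: "d > 0" "f y + d + d = a" by (simp_all add: field_simps)
  have "\<forall>\<^sub>F z in at y. s z < s y + d" using s d by (intro order_tendstoD) auto
  moreover have "\<forall>\<^sub>F z in at y. f' y - d < f' z" using f' d by simp
  ultimately show "\<forall>\<^sub>F z in at y. f z < a"
  proof eventually_elim
    case (elim z)
    then show ?case using sum[of z] sum[of y] d by linarith
  qed
qed (rule f)

lemma continuous_on_modulus:
  fixes T :: "('k::topological_space \<Rightarrow>\<^sub>C real) \<Rightarrow> ('l::topological_space \<Rightarrow>\<^sub>C real)"
  assumes bl: "\<And>y. bounded_linear (\<lambda>g. apply_bcontfun (T g) y)"
    and g: "\<And>x. 0 \<le> apply_bcontfun g x"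
    and env: "continuous_on UNIV (envelope T)"
  shows "continuous_on UNIV (\<lambda>y. modulus (\<lambda>g. apply_bcontfun (T g) y) g)"
proof -
  let ?m = "\<lambda>y. modulus (\<lambda>g. apply_bcontfun (T g) y)"
  let ?g' = "const_bcontfun (norm g) - g"
  have g': "0 \<le> apply_bcontfun ?g' x" for x
    using norm_bounded[of g x] by simp
  have sum: "?m y g + ?m y ?g' = norm g * envelope T y" for y
    using modulus_add[OF bl[of y] g g'] modulus_const[OF bl[of y], of "norm g"]
    by (simp add: envelope_eq_modulus)
  have "(envelope T \<longlongrightarrow> envelope T y) (at y)" for y
    using env by (simp add: continuous_on_def)
  then have "((\<lambda>y. norm g * envelope T y) \<longlongrightarrow> norm g * envelope T y) (at y)" for y
    by (intro tendsto_intros)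
  from tendsto_if_lower_semicontinuous_sum[where f = "\<lambda>y. ?m y g" and f' = "\<lambda>y. ?m y ?g'",
      OF modulus_lower_semicontinuous[OF bl g] modulus_lower_semicontinuous[OF bl g'] this sum]
  have "((\<lambda>y. ?m y g) \<longlongrightarrow> ?m y g) (at y)" for y .
  then show ?thesis by (simp add: continuous_on_def)
qed

lemma continuous_on_modulus_ext:
  fixes T :: "('k::topological_space \<Rightarrow>\<^sub>C real) \<Rightarrow> ('l::topological_space \<Rightarrow>\<^sub>C real)"
  assumes "\<And>y. bounded_linear (\<lambda>g. apply_bcontfun (T g) y)"
    and "continuous_on UNIV (envelope T)"
  shows "continuous_on UNIV (\<lambda>y. modulus_ext (\<lambda>g. apply_bcontfun (T g) y) g)"
  unfolding modulus_ext_def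
  by (intro continuous_on_diff continuous_on_modulus[OF assms(1) _ assms(2)] bcontfun_add_norm_nonneg)
    simp

section \<open>The positive embedding\<close>

lemma continuous_on_prod_bool:
  fixes f :: "'l::topological_space \<times> bool \<Rightarrow> 'b::topological_space"
  assumes "\<And>b. continuous_on UNIV (\<lambda>y. f (y, b))"
  shows "continuous_on UNIV f"
proof -
  have "continuous_on (UNIV \<times> {b}) f" for b
  proof -
    have "continuous_on (UNIV \<times> {b}) ((\<lambda>y. f (y, b)) \<circ> fst)"
      by (intro continuous_on_compose continuous_on_fst continuous_on_id)
        (use assms in \<open>auto intro: continuous_on_subset\<close>)
    then show ?thesis by (rule continuous_on_eq) auto
  qed
  moreover have "open ((UNIV :: 'l set) \<times> {b :: bool})" for b
    by (intro open_Times open_UNIV open_discrete)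
  ultimately have "continuous_on (\<Union>b. (UNIV :: 'l set) \<times> {b :: bool}) f"
    by (intro continuous_on_open_UN)
  moreover have "(\<Union>b. (UNIV :: 'l set) \<times> {b :: bool}) = UNIV" by auto
  ultimately show ?thesis by simp
qed

theorem theorem6p3:
  fixes T :: "('k::t2_space \<Rightarrow>\<^sub>C real) \<Rightarrow> ('l::t2_space \<Rightarrow>\<^sub>C real)"
  assumes "compact (UNIV :: 'k set)"
    and "compact (UNIV :: 'l set)"
    and "isomorphic_embedding T"
    and "continuous_on UNIV (envelope T)"
    and "\<And>y. envelope T y > 0"
  shows "\<exists>S :: ('k \<Rightarrow>\<^sub>C real) \<Rightarrow> (('l \<times> bool) \<Rightarrow>\<^sub>C real).
    isomorphic_embedding S \<and> positive_operator S"
proof -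
  obtain m1 m2 where lin: "linear T" and m: "m1 > 0" "m2 > 0"
    and lower: "\<And>g. m1 * norm g \<le> norm (T g)" and upper: "\<And>g. norm (T g) \<le> m2 * norm g"
    using assms(3) unfolding isomorphic_embedding_def by auto
  note bl = bounded_linear_apply_bcontfun[OF lin upper]
  define M where "M y = modulus_ext (\<lambda>g. apply_bcontfun (T g) y)" for y
  have M_lin: "linear (M y)" for y
    unfolding M_def by (rule linear_modulus_ext[OF bl])
  have T_bound: "\<bar>apply_bcontfun (T g) y\<bar> \<le> m2 * norm g" for g y
    using norm_bounded[of "T g" y] upper[of g] by simp
  have M_bound: "\<bar>M y g\<bar> \<le> m2 * norm g" for y g
    unfolding M_def using m T_bound by (intro abs_modulus_ext_le[OF bl]) auto

  \<comment> \<open>the positive part of the functional at \<open>y\<close> on one copy of \<open>L\<close>, the negative part on the other\<close>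
  define s where "s g = (\<lambda>(y, b). (M y g + (if b then 1 else -1) * apply_bcontfun (T g) y) / 2)" for g
  have s_bound: "norm (s g p) \<le> m2 * norm g" for g p
    using M_bound[of "fst p" g] T_bound[of g "fst p"] by (cases p) (auto simp: s_def)
  have s_cont: "continuous_on UNIV (s g)" for g
  proof (rule continuous_on_prod_bool)
    fix b
    have "continuous_on UNIV (\<lambda>y. M y g)"
      unfolding M_def by (rule continuous_on_modulus_ext[OF bl assms(4)])
    then show "continuous_on UNIV (\<lambda>y. s g (y, b))"
      unfolding s_def prod.case by (intro continuous_intros) auto
  qed
  define S where "S g = Bcontfun (s g)" for g
  have S: "apply_bcontfun (S g) = s g" for g
    unfolding S_def by (rule Bcontfun_inverse[OF bcontfun_normI[OF s_cont s_bound]])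

  have "linear S"
    by (rule linearI; rule bcontfun_eqI)
      (auto simp: S s_def linear_add[OF M_lin] linear_scale[OF M_lin] linear_add[OF lin]
        linear_scale[OF lin] field_simps)
  moreover have "m1 / 2 * norm g \<le> norm (S g)" for g
  proof -
    have "norm (T g) \<le> 2 * norm (S g)"
    proof (rule norm_bound)
      fix y
      have "apply_bcontfun (T g) y = s g (y, True) - s g (y, False)"
        by (simp add: s_def field_simps)
      then show "norm (apply_bcontfun (T g) y) \<le> 2 * norm (S g)"
        using norm_bounded[of "S g" "(y, True)"] norm_bounded[of "S g" "(y, False)"] by (simp add: S)
    qed
    with lower[of g] show ?thesis by simp
  qed
  moreover have "norm (S g) \<le> m2 * norm g" for g
    by (rule norm_bound) (use s_bound S in simp)
  ultimately have "isomorphic_embedding S"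
    unfolding isomorphic_embedding_def using m by (meson half_gt_zero)
  moreover have "positive_operator S"
    unfolding positive_operator_def
  proof (intro allI impI)
    fix g :: "'k \<Rightarrow>\<^sub>C real" and p assume "\<forall>x. 0 \<le> apply_bcontfun g x"
    then have T_le: "\<bar>apply_bcontfun (T g) y\<bar> \<le> M y g" for y
      unfolding M_def using abs_le_modulus_ext[OF bl] by blast
    show "0 \<le> apply_bcontfun (S g) p"
    proof (cases p)
      case (Pair y b)
      then show ?thesis using T_le[of y] by (auto simp: S s_def)
    qed
  qed
  ultimately show ?thesis by blast
qed

end
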